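(* Let $a:\mathbb N\to\mathbb R$ be a real sequence, and let $q\in\mathbb Z_+$ be such that $\Delta^q a\in\ell_1$. Then $\mathcal H(a)\le q-1$.
   Context: $\mathbb N$ is the set of nonnegative integers and $\mathbb Z_+$ the set of strictly positive integers. For a real sequence $a:\mathbb N\to\mathbb R$, $\mathcal H(a)=\inf\{m\in\mathbb N:\ (a(n)/n^m)_{n\in\mathbb Z_+}\text{ is bounded from above}\}\in\mathbb N\cup\{+\infty\}$ (with $\inf\emptyset=+\infty$). The linear operator $\Delta$ on real sequences indexed by $\mathbb N$ is defined by $(\Delta a)(0)=a(0)$ and $(\Delta a)(n)=a(n)-a(n-1)$ for $n\in\mathbb Z_+$; $\Delta^q$ is its $q$-th iterate. $\ell_1$ is the space of absolutely summable sequences indexed by $\mathbb N$. *)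

theory Defs
  imports Complex_Main "HOL-Library.Extended_Nat"
begin

text \<open>On \<^typ>\<open>enat\<close> the infimum of the empty set is \<^term>\<open>\<infinity> :: enat\<close>.\<close>

definition growth_order :: "(nat \<Rightarrow> real) \<Rightarrow> enat" where
  "growth_order a = Inf {enat m | m. bdd_above ((\<lambda>n. a n / real n ^ m) ` {n. 0 < n})}"

text \<open>The convention for the value at \<open>0\<close> amounts to extending the sequence by zero to
  negative indices.\<close>

definition bdiff :: "(nat \<Rightarrow> real) \<Rightarrow> nat \<Rightarrow> real" where
  "bdiff a n = (if n = 0 then a 0 else a n - a (n - 1))"

definition ell1 :: "(nat \<Rightarrow> real) set" where
  "ell1 = {a. summable (\<lambda>n. \<bar>a n\<bar>)}"

end

theory Submission
  imports Defs
begin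

text \<open>Partial summation inverts \<open>bdiff\<close>, so \<open>a\<close> is recovered from
  its \<open>q\<close>-th difference by \<open>q\<close> summations. The first turns an absolutely
  summable sequence into a bounded one; each of the other \<open>q - 1\<close> raises the degree of
  a polynomial bound by at most one. This is
  \<open>polynomial_growth_if_bdiff_funpow_ell1\<close>.\<close>

lemma sum_bdiff: "(\<Sum>k\<le>n. bdiff a k) = a n"
  by (induction n) (auto simp: bdiff_def)

text \<open>Induction on the number of summations after the first, with \<open>a\<close> arbitrary
  because the hypothesis is applied to \<open>bdiff a\<close>. The base \<open>Suc n\<close> counts
  the terms of the partial sum up to \<open>n\<close> and keeps the bound valid at index 0.\<close>

lemma polynomial_growth_if_bdiff_funpow_ell1:
  assumes "(bdiff ^^ Suc m) a \<in> ell1"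
  shows "\<exists>C\<ge>0. \<forall>n. \<bar>a n\<bar> \<le> C * real (Suc n) ^ m"
  using assms
proof (induction m arbitrary: a)
  case 0
  then have s: "summable (\<lambda>n. \<bar>bdiff a n\<bar>)"
    by (simp add: ell1_def)
  have "\<bar>a n\<bar> \<le> (\<Sum>k. \<bar>bdiff a k\<bar>)" for n
  proof -
    have "\<bar>a n\<bar> \<le> (\<Sum>k\<le>n. \<bar>bdiff a k\<bar>)"
      using sum_abs[of "bdiff a" "{..n}"] by (simp add: sum_bdiff)
    also have "\<dots> \<le> (\<Sum>k. \<bar>bdiff a k\<bar>)"
      using s by (intro sum_le_suminf) auto
    finally show ?thesis .
  qed
  moreover have "0 \<le> (\<Sum>k. \<bar>bdiff a k\<bar>)"
    using s by (intro suminf_nonneg) auto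
  ultimately show ?case by auto
next
  case (Suc m)
  from Suc.prems have "(bdiff ^^ Suc m) (bdiff a) \<in> ell1"
    by (simp only: funpow_Suc_right o_apply)
  then obtain C where C: "0 \<le> C" "\<And>n. \<bar>bdiff a n\<bar> \<le> C * real (Suc n) ^ m"
    using Suc.IH by blast
  have "\<bar>a n\<bar> \<le> C * real (Suc n) ^ Suc m" for n
  proof -
    have "\<bar>a n\<bar> \<le> (\<Sum>k\<le>n. \<bar>bdiff a k\<bar>)"
      using sum_abs[of "bdiff a" "{..n}"] by (simp add: sum_bdiff)
    \<comment> \<open>The bound is monotone in the index, so its value at \<open>n\<close> serves
      for all \<open>Suc n\<close> terms; their number supplies the extra factor.\<close>
    also have "\<dots> \<le> (\<Sum>k\<le>n. C * real (Suc n) ^ m)"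
    proof (rule sum_mono)
      fix k assume "k \<in> {..n}"
      then have "C * real (Suc k) ^ m \<le> C * real (Suc n) ^ m"
        using C(1) by (intro mult_left_mono power_mono) auto
      with C(2)[of k] show "\<bar>bdiff a k\<bar> \<le> C * real (Suc n) ^ m"
        by linarith
    qed
    also have "\<dots> = C * real (Suc n) ^ Suc m"
      by simp
    finally show ?thesis .
  qed
  with C(1) show ?case by blast
qed

theorem proposition5p4:
  fixes a :: "nat \<Rightarrow> real" and q :: nat
  assumes "q > 0"
    and "(bdiff ^^ q) a \<in> ell1"
  shows "growth_order a \<le> enat (q - 1)"
proof -
  obtain m where q: "q = Suc m"
    using \<open>q > 0\<close> gr0_implies_Suc by blast
  obtain C where C: "0 \<le> C" "\<And>n. \<bar>a n\<bar> \<le> C * real (Suc n) ^ m"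
    using polynomial_growth_if_bdiff_funpow_ell1 assms(2) unfolding q by blast
  have "a n / real n ^ m \<le> C * 2 ^ m" if "0 < n" for n
  proof -
    have "a n \<le> C * real (Suc n) ^ m"
      using C(2)[of n] by linarith
    \<comment> \<open>For \<open>n\<close> at least 1, \<open>Suc n\<close> is at most
      \<open>2 * n\<close>; this is the source of the factor \<open>2 ^ m\<close>.\<close>
    also have "\<dots> \<le> C * (2 * real n) ^ m"
      using C(1) that by (intro mult_left_mono power_mono) auto
    finally show ?thesis
      using that by (simp add: pos_divide_le_eq power_mult_distrib mult.assoc)
  qed
  then have "bdd_above ((\<lambda>n. a n / real n ^ m) ` {n. 0 < n})"
    by (intro bdd_aboveI2) auto
  then show ?thesis
    unfolding growth_order_def q by (intro Inf_lower) auto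
qed

end
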